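(* (a) Let $\kappa\geq\omega$ be a regular cardinal. If $\mathbb P$ is a $\kappa$-homogeneous-universal poset, then $\mathbb P$ is not reversible. (b) The random poset is not reversible.
   Context: A poset $\mathbb P$ is $\kappa$-homogeneous-universal (where $\kappa$ is an infinite regular cardinal) iff $|P|=\kappa$, each isomorphism between substructures of $\mathbb P$ of size $<\kappa$ extends to an automorphism of $\mathbb P$, and each poset of size $\leq\kappa$ embeds in $\mathbb P$. The random poset is the unique (up to isomorphism) countable homogeneous universal poset, i.e. the countable poset such that each isomorphism between its finite substructures extends to an automorphism and each countable poset embeds in it. A poset $\langle P,\leq\rangle$ is reversible iff each bijection $f:P\to P$ such that $x\leq y\Rightarrow f(x)\leq f(y)$ for all $x,y\in P$ is an automorphism. *)

theory Defs
  imports Main "HOL-Library.Countable_Set"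
begin

unbundle cardinal_syntax

text \<open>
  A poset is a pair of a carrier \<open>P\<close> and a reflexive order relation \<open>r \<subseteq> P \<times> P\<close> with
  \<open>partial_order_on P r\<close>. Substructures are subsets of \<open>P\<close> with the induced order, so
  \<open>order_iso\<close> and \<open>order_embedding\<close> only consult the relations on the given carriers.
\<close>

definition order_embedding :: "'a set \<Rightarrow> 'a rel \<Rightarrow> 'b set \<Rightarrow> 'b rel \<Rightarrow> ('a \<Rightarrow> 'b) \<Rightarrow> bool" where
  "order_embedding A r B s f \<longleftrightarrow>
     inj_on f A \<and> f ` A \<subseteq> B \<and> (\<forall>x\<in>A. \<forall>y\<in>A. (x, y) \<in> r \<longleftrightarrow> (f x, f y) \<in> s)"

definition order_iso :: "'a set \<Rightarrow> 'a rel \<Rightarrow> 'b set \<Rightarrow> 'b rel \<Rightarrow> ('a \<Rightarrow> 'b) \<Rightarrow> bool" where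
  "order_iso A r B s f \<longleftrightarrow>
     bij_betw f A B \<and> (\<forall>x\<in>A. \<forall>y\<in>A. (x, y) \<in> r \<longleftrightarrow> (f x, f y) \<in> s)"

definition order_automorphism :: "'a set \<Rightarrow> 'a rel \<Rightarrow> ('a \<Rightarrow> 'a) \<Rightarrow> bool" where
  "order_automorphism P r f \<longleftrightarrow> order_iso P r P r f"

definition reversible :: "'a set \<Rightarrow> 'a rel \<Rightarrow> bool" where
  "reversible P r \<longleftrightarrow>
     (\<forall>f. bij_betw f P P \<and> (\<forall>x\<in>P. \<forall>y\<in>P. (x, y) \<in> r \<longrightarrow> (f x, f y) \<in> r)
        \<longrightarrow> order_automorphism P r f)"

text \<open>
  The cardinal \<open>\<kappa>\<close> is a cardinal order as in \<open>HOL.BNF_Cardinal_Order_Relation\<close>. A definition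
  cannot quantify over types, so the posets tested for universality have their carrier in the
  type underlying \<open>\<kappa>\<close> (and in \<open>nat\<close> for the random poset). Every poset of size at most \<open>\<kappa>\<close>
  has a copy there; see \<open>homogeneous_universal_embeds\<close> and \<open>random_poset_embeds\<close> below.
\<close>

definition homogeneous_universal :: "'k rel \<Rightarrow> 'a set \<Rightarrow> 'a rel \<Rightarrow> bool" where
  "homogeneous_universal \<kappa> P r \<longleftrightarrow>
     partial_order_on P r \<and>
     |P| =o \<kappa> \<and>
     (\<forall>A B f. A \<subseteq> P \<and> B \<subseteq> P \<and> |A| <o \<kappa> \<and> |B| <o \<kappa> \<and> order_iso A r B r f \<longrightarrow>
        (\<exists>g. order_automorphism P r g \<and> (\<forall>x\<in>A. g x = f x))) \<and>
     (\<forall>(Q :: 'k set) s. partial_order_on Q s \<and> |Q| \<le>o \<kappa> \<longrightarrow>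
        (\<exists>f. order_embedding Q s P r f))"

definition random_poset :: "'a set \<Rightarrow> 'a rel \<Rightarrow> bool" where
  "random_poset P r \<longleftrightarrow>
     partial_order_on P r \<and>
     countable P \<and>
     (\<forall>A B f. A \<subseteq> P \<and> B \<subseteq> P \<and> finite A \<and> finite B \<and> order_iso A r B r f \<longrightarrow>
        (\<exists>g. order_automorphism P r g \<and> (\<forall>x\<in>A. g x = f x))) \<and>
     (\<forall>(Q :: nat set) s. partial_order_on Q s \<and> countable Q \<longrightarrow>
        (\<exists>f. order_embedding Q s P r f))"

lemma partial_order_on_image:
  assumes "partial_order_on Q s" "inj_on h Q"
  shows "partial_order_on (h ` Q) (map_prod h h ` s)"
proof -
  have s: "s \<subseteq> Q \<times> Q" "\<And>x. x \<in> Q \<Longrightarrow> (x, x) \<in> s" "trans s" "antisym s"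
    using assms(1) unfolding partial_order_on_def preorder_on_def refl_on_def by auto
  have "map_prod h h ` s \<subseteq> h ` Q \<times> h ` Q" using s(1) by auto
  moreover have "refl_on (h ` Q) (map_prod h h ` s)"
    unfolding refl_on_def using s(2) by force
  moreover have "trans (map_prod h h ` s)"
  proof (rule transI)
    fix x y z assume "(x, y) \<in> map_prod h h ` s" "(y, z) \<in> map_prod h h ` s"
    then obtain a b c d where e: "(a, b) \<in> s" "(c, d) \<in> s" "x = h a" "y = h b" "y = h c" "z = h d"
      by auto
    then have "b = c" using s(1) assms(2) by (metis SigmaD1 SigmaD2 inj_onD subsetD)
    then have "(a, d) \<in> s" using e s(3) by (meson transD)
    then show "(x, z) \<in> map_prod h h ` s" using e by force
  qed
  moreover have "antisym (map_prod h h ` s)"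
  proof (rule antisymI)
    fix x y assume "(x, y) \<in> map_prod h h ` s" "(y, x) \<in> map_prod h h ` s"
    then obtain a b c d where e: "(a, b) \<in> s" "(c, d) \<in> s" "x = h a" "y = h b" "y = h c" "x = h d"
      by auto
    then have "b = c" "a = d" using s(1) assms(2) by (metis SigmaD1 SigmaD2 inj_onD subsetD)+
    then show "x = y" using e s(4) by (metis antisymD)
  qed
  ultimately show ?thesis unfolding partial_order_on_def preorder_on_def by blast
qed

lemma order_embedding_image:
  assumes "partial_order_on Q s" "inj_on h Q" "order_embedding (h ` Q) (map_prod h h ` s) P r f"
  shows "order_embedding Q s P r (f \<circ> h)"
proof -
  have "s \<subseteq> Q \<times> Q" using assms(1) unfolding partial_order_on_def preorder_on_def by auto
  have "(x, y) \<in> s \<longleftrightarrow> (h x, h y) \<in> map_prod h h ` s" if "x \<in> Q" "y \<in> Q" for x y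
  proof
    assume "(h x, h y) \<in> map_prod h h ` s"
    then obtain a b where "(a, b) \<in> s" "h x = h a" "h y = h b" by auto
    then show "(x, y) \<in> s" using \<open>s \<subseteq> Q \<times> Q\<close> assms(2) that by (metis SigmaD1 SigmaD2 inj_onD subsetD)
  qed force
  then show ?thesis
    using assms(2,3) unfolding order_embedding_def by (simp add: comp_inj_on image_comp)
qed

lemma homogeneous_universal_embeds:
  fixes \<kappa> :: "'k rel" and Q :: "'c set"
  assumes "homogeneous_universal \<kappa> P r" "Card_order \<kappa>" "partial_order_on Q s" "|Q| \<le>o \<kappa>"
  shows "\<exists>f. order_embedding Q s P r f"
proof -
  have "|Q| \<le>o |Field \<kappa>|"
    by (rule ordLeq_ordIso_trans[OF assms(4) ordIso_symmetric[OF card_of_Field_ordIso[OF assms(2)]]])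
  then obtain h where h: "inj_on h Q" "h ` Q \<subseteq> Field \<kappa>" by (meson card_of_ordLeq)
  have "|h ` Q| \<le>o \<kappa>" by (rule ordLeq_transitive[OF card_of_image assms(4)])
  moreover have "\<forall>(Q' :: 'k set) s'. partial_order_on Q' s' \<and> |Q'| \<le>o \<kappa> \<longrightarrow> (\<exists>f. order_embedding Q' s' P r f)"
    using assms(1) unfolding homogeneous_universal_def by (elim conjE)
  ultimately obtain f where "order_embedding (h ` Q) (map_prod h h ` s) P r f"
    using partial_order_on_image[OF assms(3) h(1)] by meson
  then show ?thesis using order_embedding_image[OF assms(3) h(1)] by blast
qed

lemma random_poset_embeds:
  fixes Q :: "'c set"
  assumes "random_poset P r" "partial_order_on Q s" "countable Q"
  shows "\<exists>f. order_embedding Q s P r f"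
proof -
  obtain h :: "'c \<Rightarrow> nat" where h: "inj_on h Q" using assms(3) unfolding countable_def by blast
  have "\<forall>(Q' :: nat set) s'. partial_order_on Q' s' \<and> countable Q' \<longrightarrow> (\<exists>f. order_embedding Q' s' P r f)"
    using assms(1) unfolding random_poset_def by (elim conjE)
  then obtain f where "order_embedding (h ` Q) (map_prod h h ` s) P r f"
    using partial_order_on_image[OF assms(2) h] by (meson countable_image assms(3))
  then show ?thesis using order_embedding_image[OF assms(2) h] by blast
qed

end

theory Submission
  imports Defs
begin

text \<open>
  Start from a map sending an incomparable pair to a comparable one and extend it, along a
  well-order of \<open>P\<close> of type \<open>|P|\<close>, to an order-preserving bijection. Only preservation is needed,
  so the back step is easy: a given value is assigned to a point incomparable to the whole
  domain so far. In the forth step, images of lower points lie strictly below images of upper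
  points, so there is a fresh point between them. Both points come from one-point extensions of
  substructures of size \<open>< |P|\<close>, which exist by universality and homogeneity.
\<close>

section \<open>One-point extensions from universality and homogeneity\<close>

lemma card_of_finite_ordLess_infinite: "finite A \<Longrightarrow> infinite B \<Longrightarrow> |A| <o |B|"
  by (meson card_of_Well_order card_of_ordLeq_finite not_ordLeq_iff_ordLess)

text \<open>The conditions on \<open>D\<close> and \<open>V\<close> are exactly those under which
  \<open>F\<close> with one new point, having \<open>D\<close> strictly below and \<open>V\<close>
  strictly above it, is again a partial order. Sizes are compared with \<open>|P|\<close>, so
  \<kappa> can be left behind.\<close>

definition extension_property :: "'a set \<Rightarrow> 'a rel \<Rightarrow> bool" where
  "extension_property P r \<longleftrightarrow>
     (\<forall>F D V. F \<subseteq> P \<and> |F| <o |P| \<and> D \<subseteq> F \<and> V \<subseteq> F \<and> D \<inter> V = {} \<and> D \<times> V \<subseteq> r \<and>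
        (\<forall>x\<in>F. \<forall>d\<in>D. (x, d) \<in> r \<longrightarrow> x \<in> D) \<and> (\<forall>x\<in>F. \<forall>v\<in>V. (v, x) \<in> r \<longrightarrow> x \<in> V) \<longrightarrow>
        (\<exists>y\<in>P - F. (\<forall>x\<in>F. (x, y) \<in> r \<longleftrightarrow> x \<in> D) \<and> (\<forall>x\<in>F. (y, x) \<in> r \<longleftrightarrow> x \<in> V)))"

text \<open>Adjoin an abstract point to \<open>F\<close> and embed the result in \<open>P\<close> by
  universality. This realises the type over a copy of \<open>F\<close>; by homogeneity an
  automorphism carries \<open>F\<close> to that copy, and pulling back along it gives the point over
  \<open>F\<close> itself.\<close>

lemma homogeneous_universal_extension_property:
  fixes \<kappa> :: "'k rel"
  assumes \<kappa>: "Cinfinite \<kappa>" and hu: "homogeneous_universal \<kappa> P r"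
  shows "extension_property P r"
  unfolding extension_property_def
proof (intro allI impI, elim conjE)
  fix F D V
  assume F: "F \<subseteq> P" "|F| <o |P|" and DV: "D \<subseteq> F" "V \<subseteq> F" "D \<inter> V = {}" "D \<times> V \<subseteq> r"
    and D: "\<forall>x\<in>F. \<forall>d\<in>D. (x, d) \<in> r \<longrightarrow> x \<in> D" and V: "\<forall>x\<in>F. \<forall>v\<in>V. (v, x) \<in> r \<longrightarrow> x \<in> V"
  have po: "partial_order_on P r" and P\<kappa>: "|P| =o \<kappa>"
    and hom: "\<And>A B f. \<lbrakk>A \<subseteq> P; B \<subseteq> P; |A| <o \<kappa>; |B| <o \<kappa>; order_iso A r B r f\<rbrakk>
       \<Longrightarrow> \<exists>g. order_automorphism P r g \<and> (\<forall>x\<in>A. g x = f x)"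
    using hu unfolding homogeneous_universal_def by simp_all
  have refl: "\<And>x. x \<in> P \<Longrightarrow> (x, x) \<in> r" and tr: "trans r" and as: "antisym r"
    using po unfolding partial_order_on_def preorder_on_def refl_on_def by auto
  have F\<kappa>: "|F| <o \<kappa>" by (rule ordLess_ordIso_trans[OF F(2) P\<kappa>])
  have infF: "\<not> finite (Field \<kappa>)" using \<kappa> by (simp add: cinfinite_def)
  \<comment> \<open>\<open>None\<close> is the new point.\<close>
  define Q where "Q = insert None (Some ` F)"
  define q where "q = {(Some x, Some y) | x y. x \<in> F \<and> y \<in> F \<and> (x, y) \<in> r}
     \<union> {(None, None)} \<union> (\<lambda>d. (Some d, None)) ` D \<union> (\<lambda>v. (None, Some v)) ` V"
  have [simp]: "(Some x, Some y) \<in> q \<longleftrightarrow> x \<in> F \<and> y \<in> F \<and> (x, y) \<in> r"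
    "(Some x, None) \<in> q \<longleftrightarrow> x \<in> D" "(None, Some y) \<in> q \<longleftrightarrow> y \<in> V" "(None, None) \<in> q" for x y
    unfolding q_def by auto
  have dv: "\<And>d v. d \<in> D \<Longrightarrow> v \<in> V \<Longrightarrow> (d, v) \<in> r" using DV(4) by blast
  have "partial_order_on Q q"
    unfolding partial_order_on_def preorder_on_def
  proof (intro conjI)
    show "q \<subseteq> Q \<times> Q" using DV unfolding q_def Q_def by auto
    show "refl_on Q q" using F refl unfolding q_def Q_def refl_on_def by auto
    show "trans q"
    proof (rule transI)
      fix u v w assume "(u, v) \<in> q" "(v, w) \<in> q"
      then show "(u, w) \<in> q"
        \<comment> \<open>A chain with middle point \<open>None\<close> needs \<open>D\<close> below
          \<open>V\<close>; one with middle point in \<open>F\<close> and \<open>None\<close> at an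
          end needs \<open>D\<close> down-closed or \<open>V\<close> up-closed.\<close>
        by (cases u; cases v; cases w)
          (simp_all add: dv, (use D V DV(1,2) in \<open>blast dest: transD[OF tr]\<close>)+)
    qed
    show "antisym q"
    proof (rule antisymI)
      fix u v assume "(u, v) \<in> q" "(v, u) \<in> q"
      then show "u = v"
        using DV(3) antisymD[OF as] by (cases u; cases v) auto
    qed
  qed
  moreover have "|Q| \<le>o \<kappa>"
  proof -
    have "|Some ` F| <o |Field \<kappa>|"
      by (rule ordLeq_ordLess_trans[OF card_of_image
            ordLess_ordIso_trans[OF F\<kappa> ordIso_symmetric[OF card_of_Field_ordIso]]]) (use \<kappa> in simp)
    moreover have "|{None :: 'a option}| <o |Field \<kappa>|"
      using infF by (simp add: card_of_finite_ordLess_infinite)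
    ultimately have "|{None} \<union> Some ` F| <o |Field \<kappa>|"
      using infF card_of_Un_ordLess_infinite by blast
    then show ?thesis
      unfolding Q_def using \<kappa> card_of_Field_ordIso ordLess_imp_ordLeq ordLeq_ordIso_trans
      by (metis insert_is_Un)
  qed
  ultimately obtain e where e: "order_embedding Q q P r e"
    using homogeneous_universal_embeds[OF hu] \<kappa> by blast
  define h where "h = e \<circ> Some"
  have e_inj: "inj_on e Q" and eP: "e ` Q \<subseteq> P"
    and e_iff: "\<And>u v. u \<in> Q \<Longrightarrow> v \<in> Q \<Longrightarrow> (u, v) \<in> q \<longleftrightarrow> (e u, e v) \<in> r"
    using e unfolding order_embedding_def by auto
  have h_inj: "inj_on h F" using e_inj unfolding h_def Q_def by (auto simp: inj_on_def)
  have h_iff: "(h x, h y) \<in> r \<longleftrightarrow> (x, y) \<in> r" if "x \<in> F" "y \<in> F" for x y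
    using that e_iff[of "Some x" "Some y"] unfolding h_def Q_def q_def by auto
  have "order_iso F r (h ` F) r h"
    unfolding order_iso_def using h_inj h_iff by (simp add: bij_betw_def)
  moreover have "h ` F \<subseteq> P" using eP unfolding h_def Q_def by auto
  moreover have "|h ` F| <o \<kappa>" by (rule ordLeq_ordLess_trans[OF card_of_image F\<kappa>])
  ultimately obtain g where g: "order_automorphism P r g" and gh: "\<forall>x\<in>F. g x = h x"
    using hom[OF F(1) _ F\<kappa>] by blast
  have g_bij: "bij_betw g P P" and g_iff: "\<And>x y. x \<in> P \<Longrightarrow> y \<in> P \<Longrightarrow> (x, y) \<in> r \<longleftrightarrow> (g x, g y) \<in> r"
    using g unfolding order_automorphism_def order_iso_def by auto
  have "e None \<in> P" using eP unfolding Q_def by auto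
  \<comment> \<open>Since \<open>g\<close> agrees with \<open>h\<close> on \<open>F\<close>, the
    preimage of \<open>e None\<close> is related to \<open>F\<close> just as \<open>None\<close> is
    in \<open>q\<close>.\<close>
  then obtain y where y: "y \<in> P" "g y = e None" using g_bij by (metis bij_betw_iff_bijections)
  have "y \<notin> F"
  proof
    assume "y \<in> F"
    then have "e (Some y) = e None" using gh y unfolding h_def by simp
    then show False using e_inj \<open>y \<in> F\<close> inj_onD[of e Q "Some y" None] unfolding Q_def by auto
  qed
  moreover have "(x, y) \<in> r \<longleftrightarrow> x \<in> D" "(y, x) \<in> r \<longleftrightarrow> x \<in> V" if "x \<in> F" for x
    using that F y gh g_iff[of x y] g_iff[of y x] e_iff[of "Some x" None] e_iff[of None "Some x"]
    unfolding h_def Q_def q_def by auto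
  ultimately show "\<exists>y\<in>P - F. (\<forall>x\<in>F. (x, y) \<in> r \<longleftrightarrow> x \<in> D) \<and> (\<forall>x\<in>F. (y, x) \<in> r \<longleftrightarrow> x \<in> V)"
    using y by blast
qed

section \<open>Order-preserving partial injections and their extension by one pair\<close>

text \<open>Partial maps are kept as graphs, so that limits are plain unions. One equivalence
  encodes both single-valuedness and injectivity; the order is preserved but need not be
  reflected.\<close>

definition partial_mono_inj :: "'a set \<Rightarrow> 'a rel \<Rightarrow> 'a rel \<Rightarrow> bool" where
  "partial_mono_inj P r G \<longleftrightarrow> G \<subseteq> P \<times> P \<and>
     (\<forall>a b c d. (a, b) \<in> G \<longrightarrow> (c, d) \<in> G \<longrightarrow> (a = c \<longleftrightarrow> b = d) \<and> ((a, c) \<in> r \<longrightarrow> (b, d) \<in> r))"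

text \<open>Every condition speaks of at most two pairs, so it can be checked inside a good
  \<open>K\<close> containing both.\<close>

lemma partial_mono_inj_directed:
  assumes "\<And>p q. p \<in> H \<Longrightarrow> q \<in> H \<Longrightarrow> \<exists>K. partial_mono_inj P r K \<and> p \<in> K \<and> q \<in> K"
  shows "partial_mono_inj P r H"
  unfolding partial_mono_inj_def
proof (intro conjI allI impI subsetI)
  fix p assume "p \<in> H"
  from assms[OF this this] show "p \<in> P \<times> P" unfolding partial_mono_inj_def by blast
next
  fix a b c d assume "(a, b) \<in> H" "(c, d) \<in> H"
  from assms[OF this] obtain K where K: "partial_mono_inj P r K" "(a, b) \<in> K" "(c, d) \<in> K" by blast
  then show "a = c \<longleftrightarrow> b = d" unfolding partial_mono_inj_def by simp
  assume "(a, c) \<in> r"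
  then show "(b, d) \<in> r" using K unfolding partial_mono_inj_def by simp
qed

text \<open>Freshness of \<open>x\<close> and \<open>y\<close> keeps the graph single-valued and
  injective; \<open>(y, y) \<in> r\<close> covers the new pair compared with itself.\<close>

lemma partial_mono_inj_insert:
  assumes "partial_mono_inj P r G" "x \<in> P" "y \<in> P" "x \<notin> Domain G" "y \<notin> Range G" "(y, y) \<in> r"
    and "\<And>a b. (a, b) \<in> G \<Longrightarrow> (a, x) \<in> r \<Longrightarrow> (b, y) \<in> r"
    and "\<And>a b. (a, b) \<in> G \<Longrightarrow> (x, a) \<in> r \<Longrightarrow> (y, b) \<in> r"
  shows "partial_mono_inj P r (insert (x, y) G)"
  unfolding partial_mono_inj_def
proof (intro conjI allI impI)
  show "insert (x, y) G \<subseteq> P \<times> P" using assms(1-3) unfolding partial_mono_inj_def by blast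
next
  fix a b c d assume "(a, b) \<in> insert (x, y) G" "(c, d) \<in> insert (x, y) G"
  then show "a = c \<longleftrightarrow> b = d"
    using assms(1,4,5) unfolding partial_mono_inj_def by (auto; metis Domain.DomainI Range.RangeI)
next
  fix a b c d assume "(a, b) \<in> insert (x, y) G" "(c, d) \<in> insert (x, y) G" "(a, c) \<in> r"
  then show "(b, d) \<in> r"
    using assms(1,6-8) unfolding partial_mono_inj_def by auto
qed

lemma partial_mono_inj_back:
  assumes "partial_order_on P r" "extension_property P r"
    and G: "partial_mono_inj P r G" "|G| <o |P|" and y: "y \<in> P"
  shows "\<exists>x. partial_mono_inj P r (insert (x, y) G)"
proof (cases "y \<in> Range G")
  case True
  then obtain x where "(x, y) \<in> G" by blast
  then show ?thesis using G(1) insert_absorb by metis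
next
  case False
  have refl: "\<And>x. x \<in> P \<Longrightarrow> (x, x) \<in> r"
    using assms(1) unfolding partial_order_on_def preorder_on_def refl_on_def by auto
  have "Domain G \<subseteq> P" using G(1) unfolding partial_mono_inj_def by auto
  moreover have "|Domain G| <o |P|"
    unfolding Domain_fst by (rule ordLeq_ordLess_trans[OF card_of_image G(2)])
  \<comment> \<open>Prescribing nothing below and nothing above makes \<open>x\<close> incomparable
    to the whole domain, so there is no relation to preserve.\<close>
  ultimately obtain x where x: "x \<in> P - Domain G" "\<forall>z\<in>Domain G. (z, x) \<notin> r \<and> (x, z) \<notin> r"
    using assms(2)[unfolded extension_property_def, rule_format, of "Domain G" "{}" "{}"] by auto
  have "partial_mono_inj P r (insert (x, y) G)"
    by (rule partial_mono_inj_insert[OF G(1)]) (use x y False refl in auto)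
  then show ?thesis ..
qed

lemma partial_mono_inj_forth:
  assumes "partial_order_on P r" "extension_property P r"
    and G: "partial_mono_inj P r G" "|G| <o |P|" and x: "x \<in> P"
  shows "\<exists>y. partial_mono_inj P r (insert (x, y) G)"
proof (cases "x \<in> Domain G")
  case True
  then obtain y where "(x, y) \<in> G" by blast
  then show ?thesis using G(1) insert_absorb by metis
next
  case False
  have refl: "\<And>x. x \<in> P \<Longrightarrow> (x, x) \<in> r" and tr: "trans r" and as: "antisym r"
    using assms(1) unfolding partial_order_on_def preorder_on_def refl_on_def by auto
  have G_sub: "G \<subseteq> P \<times> P"
    and G_inj: "\<And>a b c d. (a, b) \<in> G \<Longrightarrow> (c, d) \<in> G \<Longrightarrow> a = c \<longleftrightarrow> b = d"
    and G_mono: "\<And>a b c d. (a, b) \<in> G \<Longrightarrow> (c, d) \<in> G \<Longrightarrow> (a, c) \<in> r \<Longrightarrow> (b, d) \<in> r"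
    using G(1) unfolding partial_mono_inj_def by blast+
  \<comment> \<open>The images of points below \<open>x\<close> must go below \<open>y\<close>,
    those of points above \<open>x\<close> above \<open>y\<close>. \<open>D\<close> and
    \<open>V\<close> are the down- and up-closures of these images in the range, as the extension
    property asks for closed sets.\<close>
  define D where "D = {z \<in> Range G. \<exists>a b. (a, b) \<in> G \<and> (a, x) \<in> r \<and> (z, b) \<in> r}"
  define V where "V = {z \<in> Range G. \<exists>a b. (a, b) \<in> G \<and> (x, a) \<in> r \<and> (b, z) \<in> r}"
  \<comment> \<open>If \<open>a = c\<close>, antisymmetry would give \<open>a = x\<close>, but
    \<open>x\<close> is outside the domain. Injectivity then carries the strictness over to the
    images.\<close>
  have between: "(b, d) \<in> r \<and> b \<noteq> d" if "(a, b) \<in> G" "(c, d) \<in> G" "(a, x) \<in> r" "(x, c) \<in> r" for a b c d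
  proof -
    have "a \<noteq> c" using that False antisymD[OF as] by blast
    moreover have "(a, c) \<in> r" using that transD[OF tr] by blast
    ultimately show ?thesis using G_inj G_mono that by blast
  qed
  have DV: "(u, v) \<in> r \<and> u \<noteq> v" if uv: "u \<in> D" "v \<in> V" for u v
  proof -
    obtain a b where ab: "(a, b) \<in> G" "(a, x) \<in> r" "(u, b) \<in> r" using uv(1) unfolding D_def by blast
    obtain c d where cd: "(c, d) \<in> G" "(x, c) \<in> r" "(d, v) \<in> r" using uv(2) unfolding V_def by blast
    have bd: "(b, d) \<in> r" "b \<noteq> d" using between[OF ab(1) cd(1) ab(2) cd(2)] by auto
    have ud: "(u, d) \<in> r" by (rule transD[OF tr ab(3) bd(1)])
    have "(u, v) \<in> r" by (rule transD[OF tr ud cd(3)])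
    \<comment> \<open>A common element of \<open>D\<close> and \<open>V\<close> would lie above
      \<open>d\<close> and below \<open>b\<close>, against \<open>b\<close> being strictly below
      \<open>d\<close>.\<close>
    moreover have "u \<noteq> v"
    proof
      assume "u = v"
      then have "(d, b) \<in> r" using transD[OF tr cd(3)] ab(3) by simp
      then show False using antisymD[OF as bd(1)] bd(2) by simp
    qed
    ultimately show ?thesis ..
  qed
  have "Range G \<subseteq> P" using G_sub by auto
  moreover have "|Range G| <o |P|"
    unfolding Range_snd by (rule ordLeq_ordLess_trans[OF card_of_image G(2)])
  moreover have "D \<subseteq> Range G" "V \<subseteq> Range G" unfolding D_def V_def by auto
  moreover from DV have "D \<times> V \<subseteq> r" "D \<inter> V = {}" by auto
  moreover have "\<forall>z\<in>Range G. \<forall>d\<in>D. (z, d) \<in> r \<longrightarrow> z \<in> D"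
  proof (intro ballI impI)
    fix z u assume z: "z \<in> Range G" "u \<in> D" "(z, u) \<in> r"
    then obtain a b where ab: "(a, b) \<in> G" "(a, x) \<in> r" "(u, b) \<in> r" unfolding D_def by blast
    have "(z, b) \<in> r" by (rule transD[OF tr z(3) ab(3)])
    then show "z \<in> D" using z(1) ab(1,2) unfolding D_def by blast
  qed
  moreover have "\<forall>z\<in>Range G. \<forall>v\<in>V. (v, z) \<in> r \<longrightarrow> z \<in> V"
  proof (intro ballI impI)
    fix z v assume z: "z \<in> Range G" "v \<in> V" "(v, z) \<in> r"
    then obtain a b where ab: "(a, b) \<in> G" "(x, a) \<in> r" "(b, v) \<in> r" unfolding V_def by blast
    have "(b, z) \<in> r" by (rule transD[OF tr ab(3) z(3)])
    then show "z \<in> V" using z(1) ab(1,2) unfolding V_def by blast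
  qed
  ultimately obtain y where y: "y \<in> P - Range G"
    "\<forall>z\<in>Range G. (z, y) \<in> r \<longleftrightarrow> z \<in> D" "\<forall>z\<in>Range G. (y, z) \<in> r \<longleftrightarrow> z \<in> V"
    using assms(2)[unfolded extension_property_def, THEN spec, THEN spec, THEN spec, of "Range G" D V]
    by blast
  \<comment> \<open>By reflexivity \<open>b\<close> itself belongs to \<open>D\<close>, with
    \<open>b\<close> as its own bound.\<close>
  have "(b, y) \<in> r" if "(a, b) \<in> G" "(a, x) \<in> r" for a b
    using that y G_sub refl unfolding D_def by blast
  moreover have "(y, b) \<in> r" if "(a, b) \<in> G" "(x, a) \<in> r" for a b
    using that y G_sub refl unfolding V_def by blast
  ultimately have "partial_mono_inj P r (insert (x, y) G)"
    using x y(1) False refl by (intro partial_mono_inj_insert[OF G(1)]) auto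
  then show ?thesis ..
qed

text \<open>A forth step followed by a back step serves \<open>x\<close> as argument and as value.
  The pairs go into \<open>S\<close> even if \<open>G\<close> has them already; that
  \<open>S\<close> is finite is what later bounds the size of the stages.\<close>

lemma partial_mono_inj_step:
  assumes "partial_order_on P r" "extension_property P r" "infinite P"
    and G: "partial_mono_inj P r G" "|G| <o |P|" and x: "x \<in> P"
  shows "\<exists>S. finite S \<and> partial_mono_inj P r (G \<union> S) \<and> x \<in> Domain S \<and> x \<in> Range S"
proof -
  obtain y where y: "partial_mono_inj P r (insert (x, y) G)"
    using partial_mono_inj_forth[OF assms(1,2) G x] by blast
  have "|{(x, y)} \<union> G| <o |P|"
    using card_of_Un_ordLess_infinite[OF assms(3) card_of_finite_ordLess_infinite G(2)] assms(3) by blast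
  then have "|insert (x, y) G| <o |P|" by simp
  from partial_mono_inj_back[OF assms(1,2) y this x]
  obtain z where "partial_mono_inj P r (insert (z, x) (insert (x, y) G))" ..
  then have "partial_mono_inj P r (G \<union> {(z, x), (x, y)})" by simp
  moreover have "finite {(z, x), (x, y)}" "x \<in> Domain {(z, x), (x, y)}" "x \<in> Range {(z, x), (x, y)}"
    by blast+
  ultimately show ?thesis by (intro exI conjI)
qed

section \<open>Transfinite back-and-forth along a well-order of the poset\<close>

text \<open>With finite pieces the union has size at most \<open>|I|\<close> if \<open>I\<close> is
  infinite, and is finite otherwise.\<close>

lemma card_of_UNION_finite_ordLess:
  assumes "infinite B" "|I| <o |B|" "\<And>i. i \<in> I \<Longrightarrow> finite (A i)"
  shows "|\<Union>i\<in>I. A i| <o |B|"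
proof (cases "finite I")
  case True
  show ?thesis
    by (rule card_of_finite_ordLess_infinite[OF finite_UN_I[OF True assms(3)] assms(1)])
next
  case False
  have "\<forall>i\<in>I. |A i| \<le>o |I|"
  proof
    fix i assume "i \<in> I"
    show "|A i| \<le>o |I|"
      by (rule ordLess_imp_ordLeq[OF card_of_finite_ordLess_infinite[OF assms(3)[OF \<open>i \<in> I\<close>] False]])
  qed
  from card_of_UNION_ordLeq_infinite[OF False ordIso_imp_ordLeq[OF card_of_refl] this] assms(2)
  show ?thesis by (rule ordLeq_ordLess_trans)
qed

lemma partial_mono_inj_total:
  assumes po: "partial_order_on P r" and ext: "extension_property P r" and inf: "infinite P"
    and G: "partial_mono_inj P r G" "finite G"
  shows "\<exists>H. G \<subseteq> H \<and> partial_mono_inj P r H \<and> Domain H = P \<and> Range H = P"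
proof -
  let ?w = "|P|"
  interpret w: wo_rel ?w by (simp add: wo_rel_def card_of_Well_order)
  \<comment> \<open>\<open>stage S x\<close> is the graph built before \<open>x\<close> is treated,
    and \<open>S y\<close> holds the pairs contributed at \<open>y\<close>.\<close>
  define stage where "stage S x = G \<union> (\<Union>y\<in>underS ?w x. S y)" for S :: "'a \<Rightarrow> 'a rel" and x
  \<comment> \<open>The recursion runs over the whole type, so the requirement is made vacuous
    outside \<open>P\<close>.\<close>
  define ok where "ok S x T \<longleftrightarrow> (x \<in> P \<longrightarrow>
    finite T \<and> partial_mono_inj P r (stage S x \<union> T) \<and> x \<in> Domain T \<and> x \<in> Range T)" for S x T
  have below: "y \<in> underS ?w x \<longleftrightarrow> (y, x) \<in> ?w - Id" for x y unfolding underS_def by auto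
  have underS_P: "underS ?w x \<subseteq> P" for x
    unfolding underS_def using Field_card_of[of P] by (auto simp: Field_def)
  \<comment> \<open>Two pairs of the union lie together in the graph reached at the later of their
    two indices. Pairs of \<open>G\<close> are in every stage, so any element of the nonempty
    \<open>X\<close> serves as their index.\<close>
  have directed: "\<exists>y\<in>X. p \<in> stage S y \<union> S y \<and> p' \<in> stage S y \<union> S y"
    if X: "X \<noteq> {}" "X \<subseteq> P" and pp': "p \<in> G \<union> (\<Union>y\<in>X. S y)" "p' \<in> G \<union> (\<Union>y\<in>X. S y)"
    for X p p' and S :: "'a \<Rightarrow> 'a rel"
  proof -
    have eventually: "\<exists>y\<in>X. \<forall>z. (y, z) \<in> ?w \<longrightarrow> p \<in> stage S z \<union> S z"
      if p: "p \<in> G \<union> (\<Union>y\<in>X. S y)" for p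
    proof (cases "p \<in> G")
      case True
      then show ?thesis using X(1) unfolding stage_def by blast
    next
      case False
      then obtain y where "y \<in> X" "p \<in> S y" using p by blast
      moreover have "p \<in> stage S z \<union> S z" if "(y, z) \<in> ?w" for z
        using that \<open>p \<in> S y\<close> below[of y z] unfolding stage_def by (cases "y = z") auto
      ultimately show ?thesis by blast
    qed
    obtain y where y: "y \<in> X" "\<And>z. (y, z) \<in> ?w \<Longrightarrow> p \<in> stage S z \<union> S z"
      using eventually[OF pp'(1)] by blast
    obtain y' where y': "y' \<in> X" "\<And>z. (y', z) \<in> ?w \<Longrightarrow> p' \<in> stage S z \<union> S z"
      using eventually[OF pp'(2)] by blast
    have tot: "(u, v) \<in> ?w \<or> (v, u) \<in> ?w" if "u \<in> X" "v \<in> X" for u v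
      using that subsetD[OF X(2)] w.TOTALS by (simp add: Field_card_of)
    show ?thesis
    proof (cases "(y, y') \<in> ?w")
      case True
      then show ?thesis using y(2) y' tot[of y' y'] by blast
    next
      case False
      then show ?thesis using y y'(1) y'(2)[of y] tot[of y y'] tot[of y y] by blast
    qed
  qed
  \<comment> \<open>Needed twice: with the predecessors of \<open>x\<close> for the stages, and with
    \<open>P\<close> for the final graph.\<close>
  have union: "partial_mono_inj P r (G \<union> (\<Union>y\<in>X. S y))"
    if X: "X \<subseteq> P" and S: "\<And>y. y \<in> X \<Longrightarrow> partial_mono_inj P r (stage S y \<union> S y)"
    for X and S :: "'a \<Rightarrow> 'a rel"
  proof (cases "X = {}")
    case True
    then show ?thesis using G by simp
  next
    case False
    show ?thesis
    proof (rule partial_mono_inj_directed)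
      fix p p' assume "p \<in> G \<union> (\<Union>y\<in>X. S y)" "p' \<in> G \<union> (\<Union>y\<in>X. S y)"
      from directed[OF False X this]
      obtain y where "y \<in> X" "p \<in> stage S y \<union> S y" "p' \<in> stage S y \<union> S y" by blast
      then show "\<exists>K. partial_mono_inj P r K \<and> p \<in> K \<and> p' \<in> K" using S[of y] by blast
    qed
  qed
  have "\<exists>S. \<forall>x. ok S x (S x)"
  \<comment> \<open>Dependent choice along the well-order: the first goal says that
    \<open>ok\<close> at \<open>x\<close> sees only values at strict predecessors, the second
    performs the step.\<close>
  proof (rule dependent_wf_choice[OF w.WF])
    fix f g :: "'a \<Rightarrow> 'a rel" and x T
    assume "\<And>z. (z, x) \<in> ?w - Id \<Longrightarrow> f z = g z"
    then have "stage f x = stage g x" unfolding stage_def using below by simp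
    then show "ok f x T = ok g x T" unfolding ok_def by simp
  next
    fix x and S :: "'a \<Rightarrow> 'a rel"
    assume IH: "\<And>y. (y, x) \<in> ?w - Id \<Longrightarrow> ok S y (S y)"
    show "\<exists>T. ok S x T"
    proof (cases "x \<in> P")
      case True
      have S: "finite (S y)" "partial_mono_inj P r (stage S y \<union> S y)" if "y \<in> underS ?w x" for y
        using IH[of y] that subsetD[OF underS_P that] unfolding ok_def below by simp_all
      have G': "partial_mono_inj P r (stage S x)"
        unfolding stage_def[of S x] by (rule union[OF underS_P S(2)])
      \<comment> \<open>\<open>|P|\<close> is a cardinal order, so \<open>x\<close> has fewer than
        \<open>|P|\<close> predecessors; as each adds finitely many pairs, the stage is small enough
        for another step.\<close>
      have "|underS ?w x| <o ?w"
        using True by (intro card_of_underS card_of_Card_order) (simp add: Field_card_of)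
      then have "|\<Union>y\<in>underS ?w x. S y| <o |P|"
        by (rule card_of_UNION_finite_ordLess[OF inf _ S(1)])
      then have "|stage S x| <o |P|"
        unfolding stage_def
        by (rule card_of_Un_ordLess_infinite[OF inf card_of_finite_ordLess_infinite[OF G(2) inf]])
      from partial_mono_inj_step[OF po ext inf G' this True]
      show ?thesis unfolding ok_def by simp
    qed (simp add: ok_def)
  qed
  then obtain S where S: "\<And>x. ok S x (S x)" by blast
  define H where "H = G \<union> (\<Union>x\<in>P. S x)"
  have "partial_mono_inj P r H"
    unfolding H_def
  proof (rule union)
    fix y assume "y \<in> P"
    then show "partial_mono_inj P r (stage S y \<union> S y)" using S[of y] unfolding ok_def by simp
  qed simp
  moreover from this have "Domain H \<subseteq> P" "Range H \<subseteq> P" unfolding partial_mono_inj_def by auto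
  moreover have "P \<subseteq> Domain H" "P \<subseteq> Range H"
    using S unfolding H_def ok_def by blast+
  moreover have "G \<subseteq> H" unfolding H_def by blast
  ultimately show ?thesis by blast
qed

section \<open>A bijection that preserves the order but does not reflect it\<close>

lemma extension_property_not_reversible:
  assumes po: "partial_order_on P r" and ext: "extension_property P r" and inf: "infinite P"
  shows "\<not> reversible P r"
proof
  assume rev: "reversible P r"
  have refl: "\<And>x. x \<in> P \<Longrightarrow> (x, x) \<in> r"
    using po unfolding partial_order_on_def preorder_on_def refl_on_def by auto
  have small: "|A| <o |P|" if "finite A" for A :: "'a set"
    using that inf by (rule card_of_finite_ordLess_infinite)
  obtain a where a: "a \<in> P" using inf by fastforce
  \<comment> \<open>Empty prescriptions over \<open>{a}\<close> give a point \<open>b\<close>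
    incomparable to \<open>a\<close>; prescribing \<open>a\<close> below gives \<open>c\<close>
    strictly above \<open>a\<close>.\<close>
  obtain b where b: "b \<in> P" "b \<noteq> a" "(a, b) \<notin> r" "(b, a) \<notin> r"
    using ext[unfolded extension_property_def, rule_format, of "{a}" "{}" "{}"] a small by auto
  obtain c where c: "c \<in> P" "c \<noteq> a" "(a, c) \<in> r" "(c, a) \<notin> r"
    using ext[unfolded extension_property_def, rule_format, of "{a}" "{a}" "{}"] a small by auto
  \<comment> \<open>Since \<open>a\<close> and \<open>b\<close> are incomparable, only reflexive
    pairs have to be preserved. Any extension sends this incomparable pair to the comparable pair
    \<open>a\<close>, \<open>c\<close>, so it cannot be an automorphism.\<close>
  have "partial_mono_inj P r {(a, a), (b, c)}"
    using a b c refl unfolding partial_mono_inj_def by auto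
  from partial_mono_inj_total[OF po ext inf this]
  obtain H where H: "{(a, a), (b, c)} \<subseteq> H" "partial_mono_inj P r H" "Domain H = P" "Range H = P"
    by auto
  have H_inj: "\<And>a b c d. (a, b) \<in> H \<Longrightarrow> (c, d) \<in> H \<Longrightarrow> a = c \<longleftrightarrow> b = d"
    and H_mono: "\<And>a b c d. (a, b) \<in> H \<Longrightarrow> (c, d) \<in> H \<Longrightarrow> (a, c) \<in> r \<Longrightarrow> (b, d) \<in> r"
    using H(2) unfolding partial_mono_inj_def by blast+
  have "\<forall>x\<in>P. \<exists>y. (x, y) \<in> H" using H(3) by blast
  then obtain f where f: "\<And>x. x \<in> P \<Longrightarrow> (x, f x) \<in> H" by metis
  have f_eq: "f x = y" if "(x, y) \<in> H" for x y
    using H_inj f that H(3) by (metis Domain.DomainI)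
  have "bij_betw f P P"
  proof (rule bij_betw_imageI)
    show "inj_on f P" using H_inj f by (metis inj_onI)
    show "f ` P = P"
    proof (intro equalityI subsetI)
      fix y assume "y \<in> f ` P"
      then show "y \<in> P" using f H(4) by blast
    next
      fix y assume "y \<in> P"
      then obtain x where "(x, y) \<in> H" using H(4) by blast
      then show "y \<in> f ` P" using f_eq H(3) by blast
    qed
  qed
  moreover have "\<forall>x\<in>P. \<forall>y\<in>P. (x, y) \<in> r \<longrightarrow> (f x, f y) \<in> r" using H_mono f by blast
  ultimately have "order_automorphism P r f" using rev unfolding reversible_def by blast
  then have "(a, b) \<in> r \<longleftrightarrow> (f a, f b) \<in> r"
    using a b unfolding order_automorphism_def order_iso_def by blast
  moreover have "f a = a" "f b = c" using f_eq H(1) by auto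
  ultimately show False using b c by simp
qed

lemma homogeneous_universal_not_reversible:
  fixes \<kappa> :: "'k rel"
  assumes \<kappa>: "Cinfinite \<kappa>" and hu: "homogeneous_universal \<kappa> P r"
  shows "\<not> reversible P r"
proof (rule extension_property_not_reversible)
  show "partial_order_on P r" using hu unfolding homogeneous_universal_def by simp
  show "extension_property P r" by (rule homogeneous_universal_extension_property[OF assms])
  have "|P| =o \<kappa>" using hu unfolding homogeneous_universal_def by simp
  then have "natLeq \<le>o |P|"
    by (rule ordLeq_ordIso_trans[OF natLeq_ordLeq_cinfinite[OF \<kappa>] ordIso_symmetric])
  then show "infinite P" using infinite_iff_natLeq_ordLeq by blast
qed

section \<open>The random poset as the countable case\<close>

lemma countable_iff_ordLeq_natLeq: "countable A \<longleftrightarrow> |A| \<le>o natLeq"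
proof -
  have "countable A \<longleftrightarrow> |A| \<le>o |UNIV :: nat set|"
    unfolding countable_def card_of_ordLeq[symmetric] by simp
  also have "\<dots> \<longleftrightarrow> |A| \<le>o natLeq"
    using card_of_nat ordIso_symmetric ordLeq_ordIso_trans by blast
  finally show ?thesis .
qed

text \<open>Finite means below \<open>natLeq\<close> and countable means at most
  \<open>natLeq\<close>, so the clauses match. The cardinality needs an argument, since
  \<open>random_poset\<close> bounds it only from above.\<close>

lemma random_poset_homogeneous_universal:
  assumes "random_poset P r"
  shows "homogeneous_universal natLeq P r"
proof -
  \<comment> \<open>The identity relation makes the naturals an infinite antichain; its embedding
    into \<open>P\<close> shows that \<open>P\<close> is infinite.\<close>
  have "partial_order_on (UNIV :: nat set) Id"
    by (simp add: partial_order_on_def preorder_on_def refl_on_def trans_def antisym_def)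
  then obtain f :: "nat \<Rightarrow> 'a" where "order_embedding UNIV Id P r f"
    using random_poset_embeds[OF assms] by blast
  then have "infinite P"
    unfolding order_embedding_def by (meson finite_imageD finite_subset infinite_UNIV_nat)
  then have "natLeq \<le>o |P|" using infinite_iff_natLeq_ordLeq by blast
  moreover have "|P| \<le>o natLeq"
    using assms unfolding random_poset_def countable_iff_ordLeq_natLeq by simp
  ultimately have "|P| =o natLeq" by (simp add: ordIso_iff_ordLeq)
  then show ?thesis
    using assms
    unfolding random_poset_def homogeneous_universal_def countable_iff_ordLeq_natLeq
      finite_iff_ordLess_natLeq
    by (elim conjE) (intro conjI)
qed

theorem proposition4p2:
  fixes \<kappa> :: "'k rel"
    and P :: "'a set" and r :: "'a rel"
    and R :: "'b set" and s :: "'b rel"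
  shows "(Cinfinite \<kappa> \<and> regularCard \<kappa> \<and> homogeneous_universal \<kappa> P r \<longrightarrow> \<not> reversible P r) \<and>
         (random_poset R s \<longrightarrow> \<not> reversible R s)"
  by (meson homogeneous_universal_not_reversible random_poset_homogeneous_universal natLeq_Cinfinite)

end
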